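(* Let $g:\mathbb{R}^n\to\mathbb{R}^n$ be Lipschitz continuous with a constant $\kappa<1$, and let $g$ be differentiable at $x^*$, where $x^*$ is the fixed point of $g$. Let $\{x^k\}$ be generated by the regularized Anderson acceleration algorithm (LM-AA, described in the context) with stopping threshold $\epsilon_f=0$ and with $c\in(0,1)$ satisfying $c\ge\kappa$, and assume the algorithm does not terminate after finitely many steps. Suppose that for the solutions $\bar\alpha^k\in\operatorname{argmin}_{\alpha}\|\hat f^k(\alpha)\|^2$ of the unregularized problem there exists $M>0$ such that $\|\bar\alpha^k\|_\infty\le M$ for all $k$ sufficiently large. Then, for $k\to\infty$, $$\|f^{k+1}\|\le\kappa\,\theta_k\|f^{k_0}\|+o\Big(\sum_{i=0}^{m}\|f^{k-i}\|\Big),$$ where $\theta_k:=\|\hat f^k(\bar\alpha^k)\|/\|f^{k_0}\|$. In addition, the sequence of residuals $\{\|f^k\|\}$ converges r-linearly to zero with a rate arbitrarily close to $\kappa$, i.e., for every $\eta\in(\kappa,1)$ there exist $C>0$ and $\hat\ell\in\mathbb{N}$ such that $$\|f^k\|\le C\eta^k\quad\text{for all }k\ge\hat\ell.$$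
   Context: $\|\cdot\|$ is the Euclidean norm on $\mathbb{R}^n$, and $f(x):=g(x)-x$. The solution $\bar\alpha^k$ of the unregularized problem need not be unique; $\bar\alpha^k$ denotes a chosen solution for each $k$. LM-AA algorithm. Input: a mapping $g:\mathbb{R}^n\to\mathbb{R}^n$ with residual $f(x)=g(x)-x$; a starting point $x^0\in\mathbb{R}^n$; a memory parameter $m\in\mathbb{N}$, $m\ge1$; constants $\mu_0>0$, $0<p_1<p_2<1$, $0<\eta_2<1<\eta_1$, $0<c<1$, $\gamma\in(0,\frac{1}{m+1})$. For $k=0,1,2,\dots$ perform the following steps. 1. Compute $g^k:=g(x^k)$ and $f^k:=f(x^k)=g^k-x^k$. With stopping threshold $\epsilon_f=0$: if $f^k=0$, terminate. 2. Let $m_k:=\min\{m,k\}$. Let $k_0$ be the largest index in $\{k,k-1,\dots,k-m_k\}$ at which $\|f^i\|$ is minimal over $i\in\{k,k-1,\dots,k-m_k\}$, and let $k_1,\dots,k_{m_k}$ be an enumeration of the remaining indices of $\{k,\dots,k-m_k\}$. 3. For $\alpha\in\mathbb{R}^{m_k}$ define $\hat f^k(\alpha):=f^{k_0}+\sum_{i=1}^{m_k}\alpha_i(f^{k_i}-f^{k_0})$ and $\hat g^k(\alpha):=g^{k_0}+\sum_{i=1}^{m_k}\alpha_i(g^{k_i}-g^{k_0})$ (for $k=0$ the sums are empty). 4. Set $\lambda_k:=\mu_k\|f^{k_0}\|^2$ and let $\alpha^k:=\operatorname{argmin}_{\alpha\in\mathbb{R}^{m_k}}\|\hat f^k(\alpha)\|^2+\lambda_k\|\alpha\|^2$.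 5. Set $r_k:=(1-m_k\gamma)\|f^{k_0}\|+\gamma\sum_{i=1}^{m_k}\|f^{k_i}\|$, $\mathrm{ared}_k:=r_k-\|f(\hat g^k(\alpha^k))\|$, $\mathrm{pred}_k:=r_k-c\|\hat f^k(\alpha^k)\|$, and $\rho_k:=\mathrm{ared}_k/\mathrm{pred}_k$. 6. Set $\mu_{k+1}:=\eta_1\mu_k$ if $\rho_k<p_1$; $\mu_{k+1}:=\mu_k$ if $\rho_k\in[p_1,p_2]$; $\mu_{k+1}:=\eta_2\mu_k$ if $\rho_k>p_2$. 7. If $\rho_k\ge p_1$ (successful iteration), set $x^{k+1}:=\hat g^k(\alpha^k)$; otherwise set $x^{k+1}:=g^{k_0}=g(x^{k_0})$. *)

theory Defs
  imports "HOL-Analysis.Analysis" "HOL-Library.Landau_Symbols"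
begin

definition residual :: "('a::real_normed_vector \<Rightarrow> 'a) \<Rightarrow> 'a \<Rightarrow> 'a" where
  "residual g y = g y - y"

definition window :: "nat \<Rightarrow> nat \<Rightarrow> nat set" where
  "window m k = {k - min m k..k}"

definition best_index :: "('a::real_normed_vector \<Rightarrow> 'a) \<Rightarrow> nat \<Rightarrow> (nat \<Rightarrow> 'a) \<Rightarrow> nat \<Rightarrow> nat" where
  "best_index g m x k =
     Max {i \<in> window m k. \<forall>j\<in>window m k. norm (residual g (x i)) \<le> norm (residual g (x j))}"

(* In the following, s k i is the index k_i (0 \<le> i \<le> min m k).  The order in which
   the indices other than k_0 are enumerated is left unspecified. *)

definition index_selection ::
  "('a::real_normed_vector \<Rightarrow> 'a) \<Rightarrow> nat \<Rightarrow> (nat \<Rightarrow> 'a) \<Rightarrow> nat \<Rightarrow> (nat \<Rightarrow> nat) \<Rightarrow> bool" where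
  "index_selection g m x k t \<longleftrightarrow>
     t 0 = best_index g m x k \<and> bij_betw t {1..min m k} (window m k - {t 0})"

(* The dimension d = min m k of the coefficient vectors varies with k, so they are
   functions on {1..d}, made unique by extensionality.  For d = 0 this is a singleton. *)

definition coeffs :: "nat \<Rightarrow> (nat \<Rightarrow> real) set" where
  "coeffs d = ({1..d} \<rightarrow>\<^sub>E UNIV)"

definition inf_norm :: "nat \<Rightarrow> (nat \<Rightarrow> real) \<Rightarrow> real" where
  "inf_norm d a = Max (insert 0 ((\<lambda>i. \<bar>a i\<bar>) ` {1..d}))"

definition affine_comb :: "nat \<Rightarrow> (nat \<Rightarrow> 'a::real_vector) \<Rightarrow> (nat \<Rightarrow> real) \<Rightarrow> 'a" where
  "affine_comb d v a = v 0 + (\<Sum>i=1..d. a i *\<^sub>R (v i - v 0))"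

definition fhat ::
  "('a::real_normed_vector \<Rightarrow> 'a) \<Rightarrow> nat \<Rightarrow> (nat \<Rightarrow> 'a) \<Rightarrow> (nat \<Rightarrow> nat \<Rightarrow> nat) \<Rightarrow> nat \<Rightarrow> (nat \<Rightarrow> real) \<Rightarrow> 'a" where
  "fhat g m x s k a = affine_comb (min m k) (\<lambda>i. residual g (x (s k i))) a"

definition ghat ::
  "('a::real_normed_vector \<Rightarrow> 'a) \<Rightarrow> nat \<Rightarrow> (nat \<Rightarrow> 'a) \<Rightarrow> (nat \<Rightarrow> nat \<Rightarrow> nat) \<Rightarrow> nat \<Rightarrow> (nat \<Rightarrow> real) \<Rightarrow> 'a" where
  "ghat g m x s k a = affine_comb (min m k) (\<lambda>i. g (x (s k i))) a"

definition unreg_solution ::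
  "('a::real_normed_vector \<Rightarrow> 'a) \<Rightarrow> nat \<Rightarrow> (nat \<Rightarrow> 'a) \<Rightarrow> (nat \<Rightarrow> nat \<Rightarrow> nat) \<Rightarrow> nat \<Rightarrow> (nat \<Rightarrow> real) \<Rightarrow> bool" where
  "unreg_solution g m x s k a \<longleftrightarrow>
     is_arg_min (\<lambda>b. (norm (fhat g m x s k b))\<^sup>2) (\<lambda>b. b \<in> coeffs (min m k)) a"

definition reg_solution ::
  "('a::real_normed_vector \<Rightarrow> 'a) \<Rightarrow> nat \<Rightarrow> (nat \<Rightarrow> 'a) \<Rightarrow> (nat \<Rightarrow> nat \<Rightarrow> nat) \<Rightarrow> nat \<Rightarrow> real \<Rightarrow> (nat \<Rightarrow> real) \<Rightarrow> bool" where
  "reg_solution g m x s k lam a \<longleftrightarrow>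
     is_arg_min (\<lambda>b. (norm (fhat g m x s k b))\<^sup>2 + lam * (L2_set b {1..min m k})\<^sup>2)
       (\<lambda>b. b \<in> coeffs (min m k)) a"

definition ref_value ::
  "('a::real_normed_vector \<Rightarrow> 'a) \<Rightarrow> nat \<Rightarrow> real \<Rightarrow> (nat \<Rightarrow> 'a) \<Rightarrow> (nat \<Rightarrow> nat \<Rightarrow> nat) \<Rightarrow> nat \<Rightarrow> real" where
  "ref_value g m \<gamma> x s k =
     (1 - real (min m k) * \<gamma>) * norm (residual g (x (s k 0)))
     + \<gamma> * (\<Sum>i=1..min m k. norm (residual g (x (s k i))))"

definition ared ::
  "('a::real_normed_vector \<Rightarrow> 'a) \<Rightarrow> nat \<Rightarrow> real \<Rightarrow> (nat \<Rightarrow> 'a) \<Rightarrow> (nat \<Rightarrow> nat \<Rightarrow> nat) \<Rightarrow> nat \<Rightarrow> (nat \<Rightarrow> real) \<Rightarrow> real" where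
  "ared g m \<gamma> x s k a = ref_value g m \<gamma> x s k - norm (residual g (ghat g m x s k a))"

definition pred ::
  "('a::real_normed_vector \<Rightarrow> 'a) \<Rightarrow> nat \<Rightarrow> real \<Rightarrow> real \<Rightarrow> (nat \<Rightarrow> 'a) \<Rightarrow> (nat \<Rightarrow> nat \<Rightarrow> nat) \<Rightarrow> nat \<Rightarrow> (nat \<Rightarrow> real) \<Rightarrow> real" where
  "pred g m c \<gamma> x s k a = ref_value g m \<gamma> x s k - c * norm (fhat g m x s k a)"

definition rho ::
  "('a::real_normed_vector \<Rightarrow> 'a) \<Rightarrow> nat \<Rightarrow> real \<Rightarrow> real \<Rightarrow> (nat \<Rightarrow> 'a) \<Rightarrow> (nat \<Rightarrow> nat \<Rightarrow> nat) \<Rightarrow> nat \<Rightarrow> (nat \<Rightarrow> real) \<Rightarrow> real" where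
  "rho g m c \<gamma> x s k a = ared g m \<gamma> x s k a / pred g m c \<gamma> x s k a"

definition lm_aa_params ::
  "nat \<Rightarrow> real \<Rightarrow> real \<Rightarrow> real \<Rightarrow> real \<Rightarrow> real \<Rightarrow> real \<Rightarrow> real \<Rightarrow> bool" where
  "lm_aa_params m \<mu>0 p1 p2 \<eta>1 \<eta>2 c \<gamma> \<longleftrightarrow>
     1 \<le> m \<and> 0 < \<mu>0 \<and> 0 < p1 \<and> p1 < p2 \<and> p2 < 1 \<and> 0 < \<eta>2 \<and> \<eta>2 < 1 \<and> 1 < \<eta>1 \<and>
     0 < c \<and> c < 1 \<and> 0 < \<gamma> \<and> \<gamma> < 1 / (real m + 1)"

definition lm_aa_step ::
  "('a::real_normed_vector \<Rightarrow> 'a) \<Rightarrow> nat \<Rightarrow> real \<Rightarrow> real \<Rightarrow> real \<Rightarrow> real \<Rightarrow> real \<Rightarrow> real \<Rightarrow>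
   (nat \<Rightarrow> 'a) \<Rightarrow> (nat \<Rightarrow> real) \<Rightarrow> (nat \<Rightarrow> nat \<Rightarrow> nat) \<Rightarrow> (nat \<Rightarrow> nat \<Rightarrow> real) \<Rightarrow> nat \<Rightarrow> bool" where
  "lm_aa_step g m p1 p2 \<eta>1 \<eta>2 c \<gamma> x \<mu> s \<alpha> k \<longleftrightarrow>
     index_selection g m x k (s k) \<and>
     reg_solution g m x s k (\<mu> k * (norm (residual g (x (s k 0))))\<^sup>2) (\<alpha> k) \<and>
     (let \<rho> = rho g m c \<gamma> x s k (\<alpha> k) in
        \<mu> (Suc k) = (if \<rho> < p1 then \<eta>1 * \<mu> k else if \<rho> \<le> p2 then \<mu> k else \<eta>2 * \<mu> k) \<and>
        x (Suc k) = (if p1 \<le> \<rho> then ghat g m x s k (\<alpha> k) else g (x (s k 0))))"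

(* The stopping threshold is 0: a step is taken only if no residual up to k vanishes,
   and the sequences are unconstrained after termination. *)

definition lm_aa_run ::
  "('a::real_normed_vector \<Rightarrow> 'a) \<Rightarrow> 'a \<Rightarrow> nat \<Rightarrow> real \<Rightarrow> real \<Rightarrow> real \<Rightarrow> real \<Rightarrow> real \<Rightarrow> real \<Rightarrow> real \<Rightarrow>
   (nat \<Rightarrow> 'a) \<Rightarrow> (nat \<Rightarrow> real) \<Rightarrow> (nat \<Rightarrow> nat \<Rightarrow> nat) \<Rightarrow> (nat \<Rightarrow> nat \<Rightarrow> real) \<Rightarrow> bool" where
  "lm_aa_run g x0 m \<mu>0 p1 p2 \<eta>1 \<eta>2 c \<gamma> x \<mu> s \<alpha> \<longleftrightarrow>
     lm_aa_params m \<mu>0 p1 p2 \<eta>1 \<eta>2 c \<gamma> \<and> x 0 = x0 \<and> \<mu> 0 = \<mu>0 \<and>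
     (\<forall>k. (\<forall>j\<le>k. residual g (x j) \<noteq> 0) \<longrightarrow> lm_aa_step g m p1 p2 \<eta>1 \<eta>2 c \<gamma> x \<mu> s \<alpha> k)"

definition theta ::
  "('a::real_normed_vector \<Rightarrow> 'a) \<Rightarrow> nat \<Rightarrow> (nat \<Rightarrow> 'a) \<Rightarrow> (nat \<Rightarrow> nat \<Rightarrow> nat) \<Rightarrow> nat \<Rightarrow> (nat \<Rightarrow> real) \<Rightarrow> real" where
  "theta g m x s k a = norm (fhat g m x s k a) / norm (residual g (x (s k 0)))"

end

theory Submission
  imports Defs
begin

text \<open>
  Along a run the residual norms contract over every window of length \<open>m + 1\<close>, on successful and on
  rejected steps alike, so they tend to zero.  Comparing the two minimisation problems gives
  \<open>\<parallel>\<alpha>\<^sup>k\<parallel> \<le> \<parallel>\<alpha>bar\<^sup>k\<parallel>\<close>, hence the coefficients stay bounded.  With bounded coefficients,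
  differentiability at the fixed point makes \<open>g\<close> commute with the affine combinations up to
  \<open>o(\<Sum>\<parallel>f\<^sup>k\<^sup>-\<^sup>i\<parallel>)\<close>, so the residual of the accelerated point is at most \<open>\<kappa>\<parallel>fhat\<^sup>k(\<alpha>\<^sup>k)\<parallel>\<close> plus that
  error.  As \<open>\<kappa> \<le> c\<close>, eventually \<open>\<rho>\<^sub>k > p\<^sub>2\<close>: all late steps are accelerated, \<open>\<mu>\<^sub>k\<close> tends to zero, and
  replacing \<open>\<alpha>\<^sup>k\<close> by \<open>\<alpha>bar\<^sup>k\<close> costs only \<open>\<surd>\<mu>\<^sub>k \<parallel>f\<^sup>k\<^sup>0\<parallel>\<close> times a constant.
\<close>

section \<open>Geometric decay from recursions over a sliding window\<close>

text \<open>\<open>B\<close> bounds a weighted maximum of the last \<open>m + 1\<close> values. With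
  \<open>B = C * \<eta> ^ j\<close> the geometric bound reproduces itself one step later, because
  the weight \<open>\<eta> ^ i\<close> cancels the shift by \<open>i\<close>.\<close>

lemma geometric_bound_from_window:
  fixes F :: "nat \<Rightarrow> real"
  assumes "\<eta> > 0"
    and window: "\<forall>\<^sub>F k in sequentially. \<forall>B. (\<forall>i\<le>m. \<eta> ^ i * F (k - i) \<le> B) \<longrightarrow> F (Suc k) \<le> \<eta> * B"
  shows "\<exists>C>0. \<forall>k. F k \<le> C * \<eta> ^ k"
proof -
  obtain l where l: "\<And>k B. k \<ge> l \<Longrightarrow> (\<forall>i\<le>m. \<eta> ^ i * F (k - i) \<le> B) \<Longrightarrow> F (Suc k) \<le> \<eta> * B"
    using window unfolding eventually_sequentially by blast
  \<comment> \<open>\<open>C\<close> covers all indices up to \<open>l + m\<close>; beyond them the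
    recursion applies and \<open>j - i\<close> is not truncated. The summand 1 keeps
    \<open>C\<close> positive.\<close>
  define C where "C = 1 + (\<Sum>i\<le>l + m. \<bar>F i\<bar> / \<eta> ^ i)"
  have C: "C > 0"
    unfolding C_def using \<open>\<eta> > 0\<close> by (intro add_pos_nonneg sum_nonneg) auto
  have "F k \<le> C * \<eta> ^ k" for k
  proof (induction k rule: less_induct)
    case (less k)
    show ?case
    proof (cases "k \<le> l + m")
      case True
      then have "\<bar>F k\<bar> / \<eta> ^ k \<le> (\<Sum>i\<le>l + m. \<bar>F i\<bar> / \<eta> ^ i)"
        using \<open>\<eta> > 0\<close> by (intro member_le_sum) auto
      then have "\<bar>F k\<bar> / \<eta> ^ k \<le> C"
        by (simp add: C_def)
      then have "\<bar>F k\<bar> \<le> C * \<eta> ^ k"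
        using \<open>\<eta> > 0\<close> by (simp add: pos_divide_le_eq)
      then show ?thesis by linarith
    next
      case False
      then obtain j where j: "k = Suc j" "j \<ge> l + m"
        by (cases k) auto
      have "\<eta> ^ i * F (j - i) \<le> C * \<eta> ^ j" if "i \<le> m" for i
      proof -
        have "\<eta> ^ i * F (j - i) \<le> \<eta> ^ i * (C * \<eta> ^ (j - i))"
          using less[of "j - i"] j \<open>\<eta> > 0\<close> by (intro mult_left_mono) auto
        also have "\<dots> = C * (\<eta> ^ i * \<eta> ^ (j - i))"
          by (simp add: mult_ac)
        also have "\<eta> ^ i * \<eta> ^ (j - i) = \<eta> ^ j"
          using that j by (simp flip: power_add)
        finally show ?thesis .
      qed
      then have "F (Suc j) \<le> \<eta> * (C * \<eta> ^ j)"
        using j by (intro l) auto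
      then show ?thesis by (simp add: j mult_ac)
    qed
  qed
  with C show ?thesis by blast
qed

section \<open>Affine combinations near the fixed point\<close>

lemma affine_comb_diff:
  "affine_comb d (\<lambda>i. v i - w i) a = affine_comb d v a - affine_comb d w a"
  by (simp add: affine_comb_def algebra_simps sum.distrib sum_subtractf)

lemma affine_comb_const [simp]: "affine_comb d (\<lambda>_. u) a = u"
  by (simp add: affine_comb_def)

lemma affine_comb_linear:
  assumes "linear A"
  shows "affine_comb d (\<lambda>i. A (v i)) a = A (affine_comb d v a)"
  by (simp add: affine_comb_def linear_add[OF assms] linear_diff[OF assms]
      linear_sum[OF assms] linear_cmul[OF assms])

text \<open>\<open>v 0\<close> enters every difference and collects the factor
  \<open>1 + M * d\<close>, each other vector only \<open>M\<close>; the constant majorises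
  both.\<close>

lemma norm_affine_comb_le:
  fixes v :: "nat \<Rightarrow> 'a::real_normed_vector"
  assumes "M \<ge> 0" and a: "\<And>i. i \<in> {1..d} \<Longrightarrow> \<bar>a i\<bar> \<le> M"
  shows "norm (affine_comb d v a) \<le> (1 + M * (real d + 1)) * (\<Sum>i=0..d. norm (v i))"
proof -
  let ?T = "\<Sum>i=1..d. norm (v i)"
  have split: "(\<Sum>i=0..d. norm (v i)) = norm (v 0) + ?T"
    by (simp add: sum.atLeast_Suc_atMost)
  have "norm (affine_comb d v a) \<le> norm (v 0) + (\<Sum>i=1..d. norm (a i *\<^sub>R (v i - v 0)))"
    unfolding affine_comb_def by (intro order.trans[OF norm_triangle_ineq] add_left_mono norm_sum)
  also have "(\<Sum>i=1..d. norm (a i *\<^sub>R (v i - v 0))) \<le> (\<Sum>i=1..d. M * (norm (v i) + norm (v 0)))"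
    using assms by (intro sum_mono) (auto intro!: mult_mono norm_triangle_ineq4)
  also have "\<dots> = M * ?T + M * real d * norm (v 0)"
    by (simp add: sum.distrib sum_distrib_left algebra_simps)
  also have "norm (v 0) + (M * ?T + M * real d * norm (v 0))
      \<le> (1 + M * (real d + 1)) * (norm (v 0) + ?T)"
  proof -
    have "0 \<le> ?T" by (intro sum_nonneg) auto
    moreover have "0 \<le> M * real d * ?T" "0 \<le> M * norm (v 0)"
      using \<open>M \<ge> 0\<close> \<open>0 \<le> ?T\<close> by auto
    ultimately show ?thesis by (simp add: algebra_simps)
  qed
  finally show ?thesis by (simp add: split)
qed

text \<open>The term \<open>\<kappa> * norm (y - z)\<close> is absorbed on the left. This turns
  linearisation errors, measured by distance to the fixed point, into errors measured by
  residuals.\<close>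

lemma dist_fixed_point_le_residual:
  assumes "\<kappa>-lipschitz_on UNIV g" "\<kappa> < 1" "g z = z"
  shows "norm (y - z) \<le> norm (residual g y) / (1 - \<kappa>)"
proof -
  have "norm (y - z) \<le> norm (g y - z) + norm (g y - y)"
    using norm_triangle_ineq4[of "g y - z" "g y - y"] by simp
  also have "norm (g y - z) \<le> \<kappa> * norm (y - z)"
    using lipschitz_onD[OF assms(1), of y z] assms(3) by (simp add: dist_norm)
  finally show ?thesis
    using assms(2) by (simp add: residual_def field_simps)
qed

text \<open>For affine \<open>g\<close> the point combined from the \<open>g (v i)\<close> is
  \<open>g\<close> of the point combined from the \<open>v i\<close>, and the Lipschitz bound
  suffices. Differentiability at \<open>z\<close> makes the mismatch of small order, with
  \<open>\<delta>\<close> uniform in points and bounded coefficients.\<close>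

lemma residual_affine_comb_le:
  fixes g :: "'a::real_normed_vector \<Rightarrow> 'a"
  assumes lip: "\<kappa>-lipschitz_on UNIV g" and "\<kappa> < 1" and fixp: "g z = z"
    and "g differentiable (at z)" and "M \<ge> 0" and "\<epsilon> > 0"
  shows "\<exists>\<delta>>0. \<forall>v a. (\<forall>i\<in>{1..d}. \<bar>a i\<bar> \<le> M) \<and> (\<Sum>i=0..d. norm (residual g (v i))) < \<delta> \<longrightarrow>
    norm (residual g (affine_comb d (\<lambda>i. g (v i)) a))
      \<le> \<kappa> * norm (affine_comb d (\<lambda>i. residual g (v i)) a)
        + \<epsilon> * (\<Sum>i=0..d. norm (residual g (v i)))"
proof -
  obtain A where A: "(g has_derivative A) (at z)"
    using assms(4) by (auto simp: differentiable_def)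
  then have linA: "linear A"
    by (simp add: has_derivative_linear)
  define K where "K = 1 + M * (real d + 1)"
  have K: "K \<ge> 1" using \<open>M \<ge> 0\<close> by (simp add: K_def)
  \<comment> \<open>Two linearisation errors arise, each at most \<open>\<epsilon>' * K * ?E\<close>
    with \<open>?E \<le> ?S / (1 - \<kappa>)\<close>; together they give
    \<open>\<epsilon> * ?S\<close>.\<close>
  define \<epsilon>' where "\<epsilon>' = \<epsilon> * (1 - \<kappa>) / (2 * K)"
  have \<epsilon>': "\<epsilon>' > 0" using assms K by (simp add: \<epsilon>'_def)
  obtain \<delta>' where \<delta>': "\<delta>' > 0"
    and deriv: "\<And>y. norm (y - z) < \<delta>' \<Longrightarrow> norm (g y - z - A (y - z)) \<le> \<epsilon>' * norm (y - z)"
    using A \<epsilon>' fixp unfolding has_derivative_at_alt by metis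
  show ?thesis
  \<comment> \<open>This radius forces \<open>K * ?E < \<delta>'\<close>, so all \<open>v i\<close>
    and also their affine combination lie where the linearisation is valid.\<close>
  proof (intro exI[of _ "(1 - \<kappa>) * \<delta>' / K"] conjI allI impI)
    show "(1 - \<kappa>) * \<delta>' / K > 0"
      using assms \<delta>' K by simp
  next
    fix v :: "nat \<Rightarrow> 'a" and a :: "nat \<Rightarrow> real"
    let ?S = "\<Sum>i=0..d. norm (residual g (v i))"
    let ?E = "\<Sum>i=0..d. norm (v i - z)"
    let ?x = "affine_comb d v a" and ?g = "affine_comb d (\<lambda>i. g (v i)) a"
    assume asm: "(\<forall>i\<in>{1..d}. \<bar>a i\<bar> \<le> M) \<and> ?S < (1 - \<kappa>) * \<delta>' / K"
    have "?E \<le> (\<Sum>i=0..d. norm (residual g (v i)) / (1 - \<kappa>))"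
      by (intro sum_mono dist_fixed_point_le_residual assms)
    then have E: "?E \<le> ?S / (1 - \<kappa>)"
      by (simp add: sum_divide_distrib)
    have "?S / (1 - \<kappa>) < \<delta>' / K"
      using asm \<open>\<kappa> < 1\<close> by (simp add: pos_divide_less_eq mult_ac)
    with E have "?E < \<delta>' / K" by linarith
    then have KE: "K * ?E < \<delta>'"
      using K by (simp add: pos_less_divide_eq mult_ac)
    have E0: "?E \<ge> 0" by (intro sum_nonneg) auto
    have near: "norm (v i - z) < \<delta>'" if "i \<in> {0..d}" for i
    proof -
      have "norm (v i - z) \<le> ?E"
        using that by (intro member_le_sum) auto
      also have "\<dots> \<le> K * ?E"
        using mult_right_mono[OF K E0] by simp
      finally show ?thesis using KE by simp
    qed
    have nx: "norm (?x - z) \<le> K * ?E"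
      using norm_affine_comb_le[of M d a "\<lambda>i. v i - z"] asm \<open>M \<ge> 0\<close>
      by (simp add: affine_comb_diff K_def)
    have 1: "norm (g ?x - z - A (?x - z)) \<le> \<epsilon>' * (K * ?E)"
      using deriv[of ?x] nx KE \<epsilon>'
      by (smt (verit) mult_left_mono)
    \<comment> \<open>Affine combinations fix constants and commute with the linear map
      \<open>A\<close>, so the error of the combination is the combination of the errors.\<close>
    have "?g - z - A (?x - z) = affine_comb d (\<lambda>i. g (v i) - z - A (v i - z)) a"
      by (simp add: affine_comb_diff affine_comb_linear[OF linA])
    then have "norm (?g - z - A (?x - z)) \<le> K * (\<Sum>i=0..d. norm (g (v i) - z - A (v i - z)))"
      using norm_affine_comb_le[of M d a "\<lambda>i. g (v i) - z - A (v i - z)"] asm \<open>M \<ge> 0\<close>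
      by (simp add: K_def)
    also have "\<dots> \<le> K * (\<Sum>i=0..d. \<epsilon>' * norm (v i - z))"
      using K near by (intro mult_left_mono sum_mono deriv) auto
    also have "\<dots> = \<epsilon>' * (K * ?E)"
      by (simp add: sum_distrib_left mult_ac)
    finally have 2: "norm (?g - z - A (?x - z)) \<le> \<epsilon>' * (K * ?E)" .
    have "norm (g ?x - ?g) \<le> 2 * \<epsilon>' * K * ?E"
      using norm_triangle_ineq4[of "g ?x - z - A (?x - z)" "?g - z - A (?x - z)"] 1 2 by simp
    also have "\<dots> \<le> 2 * \<epsilon>' * K * (?S / (1 - \<kappa>))"
      using E \<epsilon>' K by (intro mult_left_mono) auto
    also have "\<dots> = \<epsilon> * ?S"
      using K \<open>\<kappa> < 1\<close> by (simp add: \<epsilon>'_def)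
    finally have comm: "norm (g ?x - ?g) \<le> \<epsilon> * ?S" .
    \<comment> \<open>Inserting \<open>g ?x\<close> works because \<open>?g - ?x\<close> is exactly
      the combined residual.\<close>
    have "norm (residual g ?g) \<le> norm (g ?g - g ?x) + norm (g ?x - ?g)"
      unfolding residual_def using norm_triangle_ineq[of "g ?g - g ?x" "g ?x - ?g"] by simp
    also have "norm (g ?g - g ?x) \<le> \<kappa> * norm (?g - ?x)"
      using lipschitz_onD[OF lip, of ?g ?x] by (simp add: dist_norm)
    also have "?g - ?x = affine_comb d (\<lambda>i. residual g (v i)) a"
      by (simp add: residual_def affine_comb_diff)
    finally show "norm (residual g ?g)
        \<le> \<kappa> * norm (affine_comb d (\<lambda>i. residual g (v i)) a) + \<epsilon> * ?S"
      using comm by linarith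
  qed
qed

section \<open>The best index and the two least-squares problems\<close>

lemma best_index:
  "best_index g m x k \<in> window m k" (is ?in)
  "j \<in> window m k \<Longrightarrow> norm (residual g (x (best_index g m x k))) \<le> norm (residual g (x j))"
proof -
  let ?h = "\<lambda>i. norm (residual g (x i))"
  let ?B = "{i \<in> window m k. \<forall>j\<in>window m k. ?h i \<le> ?h j}"
  have fin: "finite (window m k)" and ne: "window m k \<noteq> {}"
    by (auto simp: window_def)
  \<comment> \<open>A minimiser exists on the finite window, so \<open>Max\<close> is taken over a
    nonempty set.\<close>
  have "arg_min_on ?h (window m k) \<in> ?B"
    using arg_min_if_finite[OF fin ne, of ?h] by (auto simp: not_less)
  then have "Max ?B \<in> ?B"
    using fin by (intro Max_in) auto
  then show ?in "j \<in> window m k \<Longrightarrow> ?h (best_index g m x k) \<le> ?h j"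
    by (auto simp: best_index_def)
qed

lemma unreg_solution_le:
  assumes "unreg_solution g m x s k b" "a \<in> coeffs (min m k)"
  shows "norm (fhat g m x s k b) \<le> norm (fhat g m x s k a)"
  using assms by (auto simp: unreg_solution_def is_arg_min_def not_less)

lemma reg_solution_le:
  assumes "reg_solution g m x s k lam b" "a \<in> coeffs (min m k)"
  shows "(norm (fhat g m x s k b))\<^sup>2 + lam * (L2_set b {1..min m k})\<^sup>2
    \<le> (norm (fhat g m x s k a))\<^sup>2 + lam * (L2_set a {1..min m k})\<^sup>2"
  using assms by (auto simp: reg_solution_def is_arg_min_def not_less)

text \<open>The zero vector must be restricted to be extensional. As a competitor it reproduces
  \<open>v 0\<close>, so neither minimiser does worse than the best residual.\<close>

lemma zero_coeffs: "(\<lambda>i\<in>{1..d}. 0) \<in> coeffs d"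
  by (auto simp: coeffs_def)

lemma affine_comb_zero_coeffs: "affine_comb d v (\<lambda>i\<in>{1..d}. 0) = v 0"
  by (simp add: affine_comb_def)

lemma L2_set_zero_coeffs: "L2_set (\<lambda>i\<in>{1..d}. 0) {1..d} = 0"
  by (simp add: L2_set_def)

lemma norm_fhat_unreg_le:
  assumes "unreg_solution g m x s k b"
  shows "norm (fhat g m x s k b) \<le> norm (residual g (x (s k 0)))"
  using unreg_solution_le[OF assms zero_coeffs] unfolding fhat_def affine_comb_zero_coeffs .

lemma norm_fhat_reg_le:
  assumes "reg_solution g m x s k lam b" "lam \<ge> 0"
  shows "norm (fhat g m x s k b) \<le> norm (residual g (x (s k 0)))"
proof -
  have "(norm (fhat g m x s k b))\<^sup>2 + lam * (L2_set b {1..min m k})\<^sup>2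
      \<le> (norm (residual g (x (s k 0))))\<^sup>2"
    using reg_solution_le[OF assms(1) zero_coeffs]
    unfolding L2_set_zero_coeffs fhat_def affine_comb_zero_coeffs by simp
  moreover have "0 \<le> lam * (L2_set b {1..min m k})\<^sup>2"
    using assms(2) by simp
  ultimately have "(norm (fhat g m x s k b))\<^sup>2 \<le> (norm (residual g (x (s k 0))))\<^sup>2"
    by linarith
  then show ?thesis
    by (rule power2_le_imp_le) (rule norm_ge_zero)
qed

text \<open>Each vector is optimal for its own problem; adding the two inequalities cancels the fit
  terms and leaves the penalties. The bound on the unregularised coefficients thus passes to the
  computed ones.\<close>

lemma L2_set_reg_le_unreg:
  assumes reg: "reg_solution g m x s k lam a" and "lam > 0"
    and unreg: "unreg_solution g m x s k b"
  shows "L2_set a {1..min m k} \<le> L2_set b {1..min m k}"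
proof -
  have "a \<in> coeffs (min m k)" "b \<in> coeffs (min m k)"
    using reg unreg by (auto simp: reg_solution_def unreg_solution_def is_arg_min_def)
  then have "(norm (fhat g m x s k b))\<^sup>2 \<le> (norm (fhat g m x s k a))\<^sup>2"
    and "(norm (fhat g m x s k a))\<^sup>2 + lam * (L2_set a {1..min m k})\<^sup>2
      \<le> (norm (fhat g m x s k b))\<^sup>2 + lam * (L2_set b {1..min m k})\<^sup>2"
    using unreg_solution_le[OF unreg] reg_solution_le[OF reg] by (auto intro: power_mono)
  then have "lam * (L2_set a {1..min m k})\<^sup>2 \<le> lam * (L2_set b {1..min m k})\<^sup>2"
    by linarith
  then have "(L2_set a {1..min m k})\<^sup>2 \<le> (L2_set b {1..min m k})\<^sup>2"
    using \<open>lam > 0\<close> by (rule mult_left_le_imp_le)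
  then show ?thesis
    by (rule power2_le_imp_le) simp
qed

text \<open>The unregularised solution is a competitor in the regularised problem; dropping the
  penalty on the left leaves a sum of two squares, which is at most the square of the sum.\<close>

lemma norm_fhat_reg_le_unreg:
  assumes reg: "reg_solution g m x s k lam a" and "lam \<ge> 0"
    and unreg: "unreg_solution g m x s k b"
  shows "norm (fhat g m x s k a) \<le> norm (fhat g m x s k b) + sqrt lam * L2_set b {1..min m k}"
    (is "?a \<le> ?b + ?c")
proof -
  have "b \<in> coeffs (min m k)"
    using unreg by (auto simp: unreg_solution_def is_arg_min_def)
  from reg_solution_le[OF reg this]
  have "?a\<^sup>2 + lam * (L2_set a {1..min m k})\<^sup>2 \<le> ?b\<^sup>2 + ?c\<^sup>2"
    using \<open>lam \<ge> 0\<close> by (simp add: power_mult_distrib)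
  moreover have "0 \<le> lam * (L2_set a {1..min m k})\<^sup>2" and c: "0 \<le> ?c"
    using \<open>lam \<ge> 0\<close> by auto
  moreover have "0 \<le> ?b * ?c"
    using c by simp
  ultimately have "?a\<^sup>2 \<le> (?b + ?c)\<^sup>2"
    unfolding power2_sum by linarith
  then show ?thesis
    by (rule power2_le_imp_le) (intro add_nonneg_nonneg norm_ge_zero c)
qed

lemma L2_set_le_inf_norm: "L2_set b {1..d} \<le> real d * inf_norm d b"
proof -
  have "L2_set b {1..d} \<le> (\<Sum>i\<in>{1..d}. \<bar>b i\<bar>)"
    by (rule L2_set_le_sum_abs)
  also have "\<dots> \<le> (\<Sum>i\<in>{1..d}. inf_norm d b)"
    unfolding inf_norm_def by (intro sum_mono Max_ge) auto
  finally show ?thesis by simp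
qed

section \<open>Contraction of the residuals along a run\<close>

locale lm_aa_contraction =
  fixes g :: "'a::real_normed_vector \<Rightarrow> 'a"
    and xstar x0 :: 'a
    and \<kappa> \<mu>0 p1 p2 \<eta>1 \<eta>2 c \<gamma> :: real
    and m :: nat
    and x :: "nat \<Rightarrow> 'a"
    and \<mu> :: "nat \<Rightarrow> real"
    and s :: "nat \<Rightarrow> nat \<Rightarrow> nat"
    and \<alpha> :: "nat \<Rightarrow> nat \<Rightarrow> real"
  assumes lipschitz: "\<kappa>-lipschitz_on UNIV g" and \<kappa>_less_1: "\<kappa> < 1"
    and fixed_point: "g xstar = xstar"
    and run: "lm_aa_run g x0 m \<mu>0 p1 p2 \<eta>1 \<eta>2 c \<gamma> x \<mu> s \<alpha>"
    and \<kappa>_le_c: "\<kappa> \<le> c"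
    and no_termination: "residual g (x k) \<noteq> 0"
begin

abbreviation res :: "nat \<Rightarrow> real" where
  "res k \<equiv> norm (residual g (x k))"

text \<open>For \<open>k < m\<close> truncated subtraction counts \<open>res 0\<close> repeatedly;
  identifying this sum with the sum over the window requires \<open>m \<le> k\<close>.\<close>

abbreviation res_sum :: "nat \<Rightarrow> real" where
  "res_sum k \<equiv> \<Sum>i=0..m. res (k - i)"

abbreviation lam :: "nat \<Rightarrow> real" where
  "lam k \<equiv> \<mu> k * (res (s k 0))\<^sup>2"

abbreviation ratio :: "nat \<Rightarrow> real" where
  "ratio k \<equiv> rho g m c \<gamma> x s k (\<alpha> k)"

lemma params:
  "1 \<le> m" "0 < \<mu>0" "0 < p1" "p1 < p2" "p2 < 1" "0 < \<eta>2" "\<eta>2 < 1" "1 < \<eta>1"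
  "0 < c" "c < 1" "0 < \<gamma>" "\<gamma> < 1 / (real m + 1)"
  using run by (auto simp: lm_aa_run_def lm_aa_params_def)

lemma \<kappa>_nonneg: "0 \<le> \<kappa>"
  using lipschitz by (rule lipschitz_on_nonneg)

lemma step: "lm_aa_step g m p1 p2 \<eta>1 \<eta>2 c \<gamma> x \<mu> s \<alpha> k"
  using run no_termination by (auto simp: lm_aa_run_def)

lemma \<mu>_Suc:
  "\<mu> (Suc k) = (if ratio k < p1 then \<eta>1 * \<mu> k else if ratio k \<le> p2 then \<mu> k else \<eta>2 * \<mu> k)"
  using step[of k] by (simp add: lm_aa_step_def Let_def)

lemma x_Suc: "x (Suc k) = (if p1 \<le> ratio k then ghat g m x s k (\<alpha> k) else g (x (s k 0)))"
  using step[of k] by (simp add: lm_aa_step_def Let_def)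

lemma reg: "reg_solution g m x s k (lam k) (\<alpha> k)"
  using step[of k] by (simp add: lm_aa_step_def)

lemma \<mu>_pos: "0 < \<mu> k"
proof (induction k)
  case 0
  then show ?case using run params by (simp add: lm_aa_run_def)
next
  case (Suc k)
  then show ?case using params by (simp add: \<mu>_Suc)
qed

lemma lam_pos: "0 < lam k"
  using \<mu>_pos no_termination by simp

lemma s_0: "s k 0 = best_index g m x k"
  using step[of k] by (simp add: lm_aa_step_def index_selection_def)

lemma res_s_0_le: "res (s k 0) \<le> res k"
  unfolding s_0 by (rule best_index) (simp add: window_def)

lemma bij_s:
  assumes "m \<le> k"
  shows "bij_betw (s k) {0..m} {k - m..k}"
proof -
  have w: "window m k = {k - m..k}"
    using assms by (simp add: window_def)
  have "bij_betw (s k) {1..m} ({k - m..k} - {s k 0})"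
    using step[of k] assms by (simp add: lm_aa_step_def index_selection_def w flip: s_0)
  then have "bij_betw (s k) ({1..m} \<union> {0}) (({k - m..k} - {s k 0}) \<union> {s k 0})"
    by (intro bij_betw_combine) auto
  moreover have "({k - m..k} - {s k 0}) \<union> {s k 0} = {k - m..k}"
    using best_index(1)[of g m x k] by (auto simp: s_0 w)
  moreover have "{1..m} \<union> {0} = {0..m}" by auto
  ultimately show ?thesis by simp
qed

lemma res_sum_s:
  assumes "m \<le> k"
  shows "(\<Sum>i=0..m. res (s k i)) = res_sum k"
proof -
  have "bij_betw (\<lambda>i. k - i) {0..m} {k - m..k}"
    using assms by (intro bij_betw_byWitness[where f' = "\<lambda>i. k - i"]) auto
  then show ?thesis
    using sum.reindex_bij_betw[OF bij_s[OF assms], of res] sum.reindex_bij_betw[of _ _ _ res]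
    by metis
qed

text \<open>It makes the reference value a convex combination of the window residuals with every
  weight at least \<open>\<gamma>\<close>, hence comparable to their sum and bounded by their
  maximum.\<close>

lemma \<gamma>_weight: "\<gamma> \<le> 1 - real m * \<gamma>"
  using params(12) by (simp add: field_simps)

lemma ref_value_eq:
  assumes "m \<le> k"
  shows "ref_value g m \<gamma> x s k = (1 - real m * \<gamma>) * res (s k 0) + \<gamma> * (\<Sum>i=1..m. res (s k i))"
  using assms by (simp add: ref_value_def)

lemma res_sum_le_ref_value:
  assumes "m \<le> k"
  shows "\<gamma> * res_sum k \<le> ref_value g m \<gamma> x s k"
proof -
  have "res_sum k = res (s k 0) + (\<Sum>i=1..m. res (s k i))"
    by (simp flip: res_sum_s[OF assms] add: sum.atLeast_Suc_atMost)
  moreover have "\<gamma> * res (s k 0) \<le> (1 - real m * \<gamma>) * res (s k 0)"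
    using \<gamma>_weight by (rule mult_right_mono) (rule norm_ge_zero)
  ultimately show ?thesis
    unfolding ref_value_eq[OF assms] by (simp only: distrib_left add_le_cancel_right)
qed

lemma ref_value_le:
  assumes "m \<le> k" and B: "\<And>j. j \<in> {k - m..k} \<Longrightarrow> res j \<le> B"
  shows "ref_value g m \<gamma> x s k \<le> B"
proof -
  have s: "res (s k i) \<le> B" if "i \<in> {0..m}" for i
    using bij_betwE[OF bij_s[OF assms(1)]] that by (intro B) blast
  have "(1 - real m * \<gamma>) * res (s k 0) \<le> (1 - real m * \<gamma>) * B"
    using \<gamma>_weight params(11) by (intro mult_left_mono s) auto
  moreover have "\<gamma> * (\<Sum>i=1..m. res (s k i)) \<le> \<gamma> * (\<Sum>i=1..m. B)"
    using params(11) by (intro mult_left_mono sum_mono s) auto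
  ultimately show ?thesis
    by (simp add: ref_value_eq[OF assms(1)] algebra_simps)
qed

lemma res_s_0_le_ref_value:
  assumes "m \<le> k"
  shows "res (s k 0) \<le> ref_value g m \<gamma> x s k"
proof -
  have "res (s k 0) \<le> res (s k i)" if "i \<in> {0..m}" for i
    using bij_betwE[OF bij_s[OF assms]] that assms
    by (auto simp: s_0 window_def intro!: best_index(2))
  then have "(\<Sum>i=1..m. res (s k 0)) \<le> (\<Sum>i=1..m. res (s k i))"
    by (intro sum_mono) auto
  then have "\<gamma> * (\<Sum>i=1..m. res (s k 0)) \<le> \<gamma> * (\<Sum>i=1..m. res (s k i))"
    using params(11) by (intro mult_left_mono) auto
  then show ?thesis
    by (simp add: ref_value_eq[OF assms] algebra_simps)
qed

lemma norm_fhat_le: "norm (fhat g m x s k (\<alpha> k)) \<le> res (s k 0)"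
proof -
  have "0 \<le> lam k"
    using lam_pos by (rule less_imp_le)
  with reg show ?thesis
    by (rule norm_fhat_reg_le)
qed

text \<open>The model residual is at most the best residual, hence at most the reference
  value.\<close>

lemma pred_ge:
  assumes "m \<le> k"
  shows "(1 - c) * ref_value g m \<gamma> x s k \<le> pred g m c \<gamma> x s k (\<alpha> k)"
proof -
  have "c * norm (fhat g m x s k (\<alpha> k)) \<le> c * ref_value g m \<gamma> x s k"
    by (intro mult_left_mono order.trans[OF norm_fhat_le res_s_0_le_ref_value[OF assms]]
        less_imp_le[OF params(9)])
  then show ?thesis
    unfolding pred_def left_diff_distrib by linarith
qed

lemma pred_pos:
  assumes "m \<le> k"
  shows "0 < pred g m c \<gamma> x s k (\<alpha> k)"
proof -
  have "0 < res (s k 0)" using no_termination by simp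
  also note res_s_0_le_ref_value[OF assms]
  finally have "0 < (1 - c) * ref_value g m \<gamma> x s k" using params by simp
  also note pred_ge[OF assms]
  finally show ?thesis .
qed

text \<open>An accepted step reduces the reference value by at least \<open>p1 * pred\<close>, a
  fixed fraction of it; a rejected step is a plain fixed-point step from the best point and
  contracts by \<open>\<kappa>\<close>.\<close>

lemma res_Suc_le:
  assumes k: "m \<le> k" and B: "\<And>j. j \<in> {k - m..k} \<Longrightarrow> res j \<le> B"
  shows "res (Suc k) \<le> max \<kappa> (1 - p1 * (1 - c)) * B"
proof -
  have "res k \<le> B" using B by simp
  then have B0: "0 \<le> B" by (rule order.trans[OF norm_ge_zero])
  let ?r = "ref_value g m \<gamma> x s k"
  have r: "?r \<le> B" using assms by (rule ref_value_le)
  show ?thesis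
  proof (cases "p1 \<le> ratio k")
    case True
    then have "p1 * pred g m c \<gamma> x s k (\<alpha> k) \<le> ared g m \<gamma> x s k (\<alpha> k)"
      using pred_pos[OF k] by (simp add: rho_def pos_le_divide_eq)
    moreover have "p1 * ((1 - c) * ?r) \<le> p1 * pred g m c \<gamma> x s k (\<alpha> k)"
      using pred_ge[OF k] params(3) by (intro mult_left_mono) auto
    ultimately have "p1 * (1 - c) * ?r \<le> ared g m \<gamma> x s k (\<alpha> k)"
      by simp
    then have "res (Suc k) \<le> (1 - p1 * (1 - c)) * ?r"
      using True unfolding ared_def left_diff_distrib[of 1] by (simp add: x_Suc)
    also have "\<dots> \<le> (1 - p1 * (1 - c)) * B"
    proof (intro mult_left_mono r)
      have "p1 * (1 - c) \<le> 1 * 1" using params(3,4,5,9,10) by (intro mult_mono) auto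
      then show "0 \<le> 1 - p1 * (1 - c)" by simp
    qed
    also have "\<dots> \<le> max \<kappa> (1 - p1 * (1 - c)) * B"
      using B0 by (intro mult_right_mono) auto
    finally show ?thesis .
  next
    case False
    then have "res (Suc k) \<le> \<kappa> * res (s k 0)"
      using lipschitz_onD[OF lipschitz, of "g (x (s k 0))" "x (s k 0)"]
      by (simp add: x_Suc residual_def dist_norm)
    also have "\<dots> \<le> \<kappa> * B"
      using r res_s_0_le_ref_value[OF k] \<kappa>_nonneg by (intro mult_left_mono) auto
    also have "\<dots> \<le> max \<kappa> (1 - p1 * (1 - c)) * B"
      using B0 by (intro mult_right_mono) auto
    finally show ?thesis .
  qed
qed

lemma res_tendsto_0: "res \<longlonglongrightarrow> 0"
proof -
  define q where "q = max \<kappa> (1 - p1 * (1 - c))"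
  have "0 < p1 * (1 - c)" "p1 * (1 - c) < 1"
    using params(3,4,5,9,10) mult_strict_mono[of p1 1 "1 - c" 1] by auto
  then have q: "0 < q" "q < 1"
    using \<kappa>_less_1 by (auto simp: q_def)
  \<comment> \<open>Removing the weights costs a factor \<open>1 / \<eta> ^ m\<close>, so the rate
    must satisfy \<open>\<eta> ^ Suc m = q\<close>. The root is positive even for
    \<open>\<kappa> = 0\<close>, since \<open>q\<close> dominates
    \<open>1 - p1 * (1 - c)\<close>.\<close>
  define \<eta> where "\<eta> = root (Suc m) q"
  have \<eta>: "0 < \<eta>" "\<eta> < 1" "\<eta> ^ Suc m = q"
    using q by (simp_all add: \<eta>_def del: power_Suc)
  have "\<forall>\<^sub>F k in sequentially. \<forall>B. (\<forall>i\<le>m. \<eta> ^ i * res (k - i) \<le> B) \<longrightarrow> res (Suc k) \<le> \<eta> * B"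
  proof (intro eventually_sequentiallyI[of m] allI impI)
    fix k B assume k: "m \<le> k" and B: "\<forall>i\<le>m. \<eta> ^ i * res (k - i) \<le> B"
    have "res j \<le> B / \<eta> ^ m" if "j \<in> {k - m..k}" for j
    proof -
      have "\<eta> ^ m * res j \<le> \<eta> ^ (k - j) * res j"
        using that \<eta> by (intro mult_right_mono power_decreasing) auto
      also have "\<dots> \<le> B"
        using B[rule_format, of "k - j"] that by auto
      finally show ?thesis
        using \<eta> by (simp add: pos_le_divide_eq mult_ac)
    qed
    with k have "res (Suc k) \<le> q * (B / \<eta> ^ m)"
      unfolding q_def by (rule res_Suc_le)
    also have "\<dots> = \<eta> * B"
      using \<eta>(1) by (simp flip: \<eta>(3))
    finally show "res (Suc k) \<le> \<eta> * B" .
  qed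
  then obtain C where C: "\<And>k. res k \<le> C * \<eta> ^ k"
    using geometric_bound_from_window[OF \<eta>(1), of m res] by blast
  have "(\<lambda>k. C * \<eta> ^ k) \<longlonglongrightarrow> 0"
    using \<eta> by (intro tendsto_mult_right_zero LIMSEQ_realpow_zero) auto
  then show ?thesis
    by (rule Lim_null_comparison[rotated]) (simp add: C)
qed

lemma res_sum_tendsto_0: "res_sum \<longlonglongrightarrow> 0"
proof -
  have "(\<lambda>k. res (k - i)) \<longlonglongrightarrow> 0" for i
    using res_tendsto_0 by (rule filterlim_compose) (rule filterlim_minus_const_nat_at_top)
  then show ?thesis by (intro tendsto_null_sum) auto
qed

end

section \<open>Sharp asymptotics under bounded coefficients\<close>

locale lm_aa_bounded = lm_aa_contraction +
  fixes \<alpha>bar :: "nat \<Rightarrow> nat \<Rightarrow> real" and M :: real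
  assumes differentiable: "g differentiable (at xstar)"
    and unregularized: "unreg_solution g m x s k (\<alpha>bar k)"
    and M_pos: "0 < M"
    and bounded: "\<forall>\<^sub>F k in sequentially. inf_norm (min m k) (\<alpha>bar k) \<le> M"
begin

lemma eventually_L2_set_\<alpha>bar_le:
  "\<forall>\<^sub>F k in sequentially. L2_set (\<alpha>bar k) {1..min m k} \<le> real m * M"
  using bounded
proof eventually_elim
  case (elim k)
  have "L2_set (\<alpha>bar k) {1..min m k} \<le> real (min m k) * inf_norm (min m k) (\<alpha>bar k)"
    by (rule L2_set_le_inf_norm)
  also have "\<dots> \<le> real (min m k) * M"
    using elim by (intro mult_left_mono) auto
  also have "\<dots> \<le> real m * M"
    using M_pos by (intro mult_right_mono) auto
  finally show ?case .
qed

text \<open>The computed coefficients are eventually bounded by \<open>m * M\<close>, and the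
  vanishing residual sum enters the \<open>\<delta>\<close> ball of
  \<open>residual_affine_comb_le\<close>.\<close>

lemma eventually_res_ghat_le:
  assumes "\<epsilon> > 0"
  shows "\<forall>\<^sub>F k in sequentially. norm (residual g (ghat g m x s k (\<alpha> k)))
    \<le> \<kappa> * norm (fhat g m x s k (\<alpha> k)) + \<epsilon> * res_sum k"
proof -
  have "0 \<le> real m * M" using M_pos by simp
  from residual_affine_comb_le[OF lipschitz \<kappa>_less_1 fixed_point differentiable this assms, of m]
  obtain \<delta> where "\<delta> > 0" and \<delta>:
    "\<And>v a. (\<forall>i\<in>{1..m}. \<bar>a i\<bar> \<le> real m * M) \<Longrightarrow> (\<Sum>i=0..m. norm (residual g (v i))) < \<delta> \<Longrightarrow>
      norm (residual g (affine_comb m (\<lambda>i. g (v i)) a))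
        \<le> \<kappa> * norm (affine_comb m (\<lambda>i. residual g (v i)) a)
          + \<epsilon> * (\<Sum>i=0..m. norm (residual g (v i)))"
    by blast
  have "\<forall>\<^sub>F k in sequentially. res_sum k < \<delta>"
    using order_tendstoD(2)[OF res_sum_tendsto_0 \<open>\<delta> > 0\<close>] .
  then show ?thesis
    using eventually_L2_set_\<alpha>bar_le eventually_ge_at_top[of m]
  proof eventually_elim
    case (elim k)
    have "\<bar>\<alpha> k i\<bar> \<le> real m * M" if "i \<in> {1..m}" for i
    proof -
      have "\<bar>\<alpha> k i\<bar> \<le> L2_set (\<lambda>i. \<bar>\<alpha> k i\<bar>) {1..m}"
        using that by (intro member_le_L2_set) auto
      also have "\<dots> = L2_set (\<alpha> k) {1..min m k}"
        using elim by (simp add: L2_set_def)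
      also have "\<dots> \<le> L2_set (\<alpha>bar k) {1..min m k}"
        by (rule L2_set_reg_le_unreg[OF reg lam_pos unregularized])
      finally show ?thesis using elim by linarith
    qed
    then show ?case
      using \<delta>[of "\<alpha> k" "\<lambda>i. x (s k i)"] elim by (simp add: res_sum_s ghat_def fhat_def)
  qed
qed

lemma eventually_ratio_gt: "\<forall>\<^sub>F k in sequentially. p2 < ratio k"
proof -
  \<comment> \<open>Since \<open>pred\<close> dominates
    \<open>\<gamma> * (1 - c) * res_sum k\<close>, this error is at most
    \<open>(1 - p2) / 2 * pred\<close>; then \<open>ared\<close> is at least
    \<open>(1 + p2) / 2 * pred\<close>, above \<open>p2 * pred\<close>.\<close>
  define \<epsilon> where "\<epsilon> = (1 - p2) / 2 * (\<gamma> * (1 - c))"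
  have "\<epsilon> > 0" unfolding \<epsilon>_def using params(5,10,11) by (intro mult_pos_pos) auto
  from eventually_res_ghat_le[OF this] eventually_ge_at_top[of m]
  show ?thesis
  proof eventually_elim
    case (elim k)
    let ?p = "pred g m c \<gamma> x s k (\<alpha> k)"
    have "\<gamma> * (1 - c) * res_sum k \<le> (1 - c) * ref_value g m \<gamma> x s k"
      using mult_left_mono[OF res_sum_le_ref_value[OF elim(2)], of "1 - c"] params(10)
      by (simp add: mult_ac)
    also have "\<dots> \<le> ?p" by (rule pred_ge[OF elim(2)])
    finally have "(1 - p2) / 2 * (\<gamma> * (1 - c) * res_sum k) \<le> (1 - p2) / 2 * ?p"
      using params(5) by (intro mult_left_mono) auto
    then have "\<epsilon> * res_sum k \<le> (1 - p2) / 2 * ?p"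
      by (simp add: \<epsilon>_def mult_ac)
    moreover have "\<kappa> * norm (fhat g m x s k (\<alpha> k)) \<le> c * norm (fhat g m x s k (\<alpha> k))"
      using \<kappa>_le_c by (intro mult_right_mono) auto
    ultimately have "?p - (1 - p2) / 2 * ?p \<le> ared g m \<gamma> x s k (\<alpha> k)"
      using elim by (simp add: ared_def pred_def)
    moreover have "p2 * ?p < (1 + p2) / 2 * ?p"
      using params(5) pred_pos[OF elim(2)] by (intro mult_strict_right_mono) auto
    moreover have "(1 + p2) / 2 * ?p = ?p - (1 - p2) / 2 * ?p"
      by (simp add: field_simps)
    ultimately have "p2 * ?p < ared g m \<gamma> x s k (\<alpha> k)"
      by linarith
    then show ?case
      using pred_pos[OF elim(2)] by (simp add: rho_def pos_less_divide_eq)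
  qed
qed

lemma \<mu>_tendsto_0: "\<mu> \<longlonglongrightarrow> 0"
proof -
  \<comment> \<open>A window of the single index \<open>k\<close>: late ratios exceed
    \<open>p2\<close>, so \<open>\<mu>\<close> shrinks by \<open>\<eta>2\<close> at each
    step.\<close>
  have "\<forall>\<^sub>F k in sequentially. \<forall>B. (\<forall>i\<le>0. \<eta>2 ^ i * \<mu> (k - i) \<le> B) \<longrightarrow> \<mu> (Suc k) \<le> \<eta>2 * B"
    using eventually_ratio_gt by eventually_elim (use params(3,4,6) in \<open>auto simp: \<mu>_Suc\<close>)
  then obtain C where C: "\<And>k. \<mu> k \<le> C * \<eta>2 ^ k"
    using geometric_bound_from_window[OF params(6), of 0 \<mu>] by blast
  have "(\<lambda>k. C * \<eta>2 ^ k) \<longlonglongrightarrow> 0"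
    using params(6,7) by (intro tendsto_mult_right_zero LIMSEQ_realpow_zero) auto
  then show ?thesis
    by (rule Lim_null_comparison[rotated]) (simp add: C \<mu>_pos less_imp_le)
qed

lemma eventually_res_Suc_le:
  assumes "\<epsilon> > 0"
  shows "\<forall>\<^sub>F k in sequentially.
    res (Suc k) \<le> \<kappa> * norm (fhat g m x s k (\<alpha>bar k)) + \<epsilon> * res_sum k"
proof -
  \<comment> \<open>Half of \<open>\<epsilon>\<close> pays for exchanging the two solutions, the
    other half for the nonlinearity of \<open>g\<close>.\<close>
  have "(\<lambda>k. sqrt (\<mu> k) * (real m * M)) \<longlonglongrightarrow> sqrt 0 * (real m * M)"
    by (intro tendsto_intros \<mu>_tendsto_0)
  then have "\<forall>\<^sub>F k in sequentially. sqrt (\<mu> k) * (real m * M) < \<epsilon> / 2"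
    by (rule order_tendstoD(2)) (use assms in simp)
  moreover have "\<epsilon> / 2 > 0" using assms by simp
  note eventually_res_ghat_le[OF this]
  ultimately show ?thesis
    using eventually_L2_set_\<alpha>bar_le eventually_ratio_gt eventually_ge_at_top[of m]
  proof eventually_elim
    case (elim k)
    let ?b = "norm (fhat g m x s k (\<alpha>bar k))"
    have "norm (fhat g m x s k (\<alpha> k)) \<le> ?b + sqrt (lam k) * L2_set (\<alpha>bar k) {1..min m k}"
      by (rule norm_fhat_reg_le_unreg[OF reg less_imp_le[OF lam_pos] unregularized])
    also have "sqrt (lam k) * L2_set (\<alpha>bar k) {1..min m k} \<le> sqrt (lam k) * (real m * M)"
      using elim lam_pos[of k] by (intro mult_left_mono) auto
    \<comment> \<open>The squared residual in the regularisation parameter makes the exchange cost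
      linear in the residual.\<close>
    also have "\<dots> = sqrt (\<mu> k) * (real m * M) * res (s k 0)"
      by (simp add: real_sqrt_mult)
    also have "\<dots> \<le> \<epsilon> / 2 * res_sum k"
    proof (intro mult_mono)
      show "res (s k 0) \<le> res_sum k"
        using res_s_0_le[of k] member_le_sum[of 0 "{0..m}" "\<lambda>i. res (k - i)"] by simp
    qed (use elim assms in auto)
    finally have "norm (fhat g m x s k (\<alpha> k)) \<le> ?b + \<epsilon> / 2 * res_sum k" by simp
    then have "\<kappa> * norm (fhat g m x s k (\<alpha> k)) \<le> \<kappa> * (?b + \<epsilon> / 2 * res_sum k)"
      using \<kappa>_nonneg by (rule mult_left_mono)
    moreover have "\<kappa> * (\<epsilon> / 2 * res_sum k) \<le> 1 * (\<epsilon> / 2 * res_sum k)"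
      using \<kappa>_less_1 assms by (intro mult_right_mono mult_nonneg_nonneg sum_nonneg) auto
    \<comment> \<open>Late steps are accepted because \<open>p1 < p2 < ratio k\<close>.\<close>
    moreover have "res (Suc k) \<le> \<kappa> * norm (fhat g m x s k (\<alpha> k)) + \<epsilon> / 2 * res_sum k"
      using elim params(4) by (simp add: x_Suc)
    ultimately show ?case by (simp add: algebra_simps)
  qed
qed

lemma res_Suc_asymptotic:
  "\<exists>e. e \<in> o(res_sum) \<and> (\<forall>\<^sub>F k in sequentially.
     res (k + 1) \<le> \<kappa> * theta g m x s k (\<alpha>bar k) * res (s k 0) + e k)"
proof -
  \<comment> \<open>The exact excess over the leading term, cut at zero; the preceding eventual
    bound for every \<open>\<epsilon>\<close> says that it is of small order.\<close>
  define e where "e k = max 0 (res (Suc k) - \<kappa> * norm (fhat g m x s k (\<alpha>bar k)))" for k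
  have "e \<in> o(res_sum)"
  proof (rule landau_o.smallI)
    fix \<epsilon> :: real assume "\<epsilon> > 0"
    from eventually_res_Suc_le[OF this]
    show "\<forall>\<^sub>F k in sequentially. norm (e k) \<le> \<epsilon> * norm (res_sum k)"
    proof eventually_elim
      case (elim k)
      have "0 \<le> res_sum k" by (intro sum_nonneg) auto
      then show ?case using elim \<open>\<epsilon> > 0\<close> by (simp add: e_def)
    qed
  qed
  moreover have "res (k + 1) \<le> \<kappa> * theta g m x s k (\<alpha>bar k) * res (s k 0) + e k" for k
    using no_termination by (simp add: theta_def e_def)
  ultimately show ?thesis by (auto intro: exI[of _ e])
qed

lemma res_geometric:
  assumes "\<kappa> < \<eta>" "\<eta> < 1"
  shows "\<exists>C>0. \<forall>k. res k \<le> C * \<eta> ^ k"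
proof -
  have \<eta>: "\<eta> > 0" using assms \<kappa>_nonneg by simp
  \<comment> \<open>The gap \<open>\<eta> - \<kappa>\<close> pays for the error: each of the
    \<open>m + 1\<close> residuals is at most \<open>B / \<eta> ^ m\<close>, so the error is at most
    \<open>(\<eta> - \<kappa>) * B\<close>, added to the leading
    \<open>\<kappa> * B\<close>.\<close>
  define \<epsilon> where "\<epsilon> = (\<eta> - \<kappa>) * \<eta> ^ m / (real m + 1)"
  have "\<epsilon> > 0" using assms \<eta> by (simp add: \<epsilon>_def)
  from eventually_res_Suc_le[OF this]
  have "\<forall>\<^sub>F k in sequentially. \<forall>B. (\<forall>i\<le>m. \<eta> ^ i * res (k - i) \<le> B) \<longrightarrow> res (Suc k) \<le> \<eta> * B"
  proof eventually_elim
    case (elim k)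
    show ?case
    proof (intro allI impI)
      fix B assume B: "\<forall>i\<le>m. \<eta> ^ i * res (k - i) \<le> B"
      have "norm (fhat g m x s k (\<alpha>bar k)) \<le> res k"
        using norm_fhat_unreg_le[OF unregularized] res_s_0_le by (rule order.trans)
      also have "\<dots> \<le> B" using B[rule_format, of 0] by simp
      finally have 1: "\<kappa> * norm (fhat g m x s k (\<alpha>bar k)) \<le> \<kappa> * B"
        using \<kappa>_nonneg by (rule mult_left_mono)
      have "res (k - i) \<le> B / \<eta> ^ m" if "i \<in> {0..m}" for i
      proof -
        have "\<eta> ^ m * res (k - i) \<le> \<eta> ^ i * res (k - i)"
          using that \<eta> assms by (intro mult_right_mono power_decreasing) auto
        also have "\<dots> \<le> B" using B that by simp
        finally show ?thesis using \<eta> by (simp add: pos_le_divide_eq mult_ac)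
      qed
      then have "res_sum k \<le> (\<Sum>i=0..m. B / \<eta> ^ m)"
        by (rule sum_mono)
      then have "\<epsilon> * res_sum k \<le> \<epsilon> * ((real m + 1) * (B / \<eta> ^ m))"
        using \<open>\<epsilon> > 0\<close> by (intro mult_left_mono) (auto simp: algebra_simps)
      also have "\<dots> = (\<eta> - \<kappa>) * B"
        using \<eta> by (simp add: \<epsilon>_def)
      finally show "res (Suc k) \<le> \<eta> * B"
        using 1 elim by (simp add: algebra_simps)
    qed
  qed
  then show ?thesis
    by (rule geometric_bound_from_window[OF \<eta>])
qed

end

theorem theorem3:
  fixes g :: "real ^ 'n \<Rightarrow> real ^ 'n"
    and xstar x0 :: "real ^ 'n"
    and \<kappa> \<mu>0 p1 p2 \<eta>1 \<eta>2 c \<gamma> :: real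
    and m :: nat
    and x :: "nat \<Rightarrow> real ^ 'n"
    and \<mu> :: "nat \<Rightarrow> real"
    and s :: "nat \<Rightarrow> nat \<Rightarrow> nat"
    and \<alpha> \<alpha>bar :: "nat \<Rightarrow> nat \<Rightarrow> real"
  assumes lipschitz: "\<kappa>-lipschitz_on UNIV g" and "\<kappa> < 1"
    and fixed_point: "g xstar = xstar"
    and differentiable: "g differentiable (at xstar)"
    and run: "lm_aa_run g x0 m \<mu>0 p1 p2 \<eta>1 \<eta>2 c \<gamma> x \<mu> s \<alpha>"
    and "\<kappa> \<le> c"
    and no_termination: "\<forall>k. residual g (x k) \<noteq> 0"
    and unregularized: "\<forall>k. unreg_solution g m x s k (\<alpha>bar k)"
    and bounded: "\<exists>M>0. \<forall>\<^sub>F k in sequentially. inf_norm (min m k) (\<alpha>bar k) \<le> M"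
  shows "(\<exists>e. e \<in> o(\<lambda>k. \<Sum>i=0..m. norm (residual g (x (k - i)))) \<and>
            (\<forall>\<^sub>F k in sequentially.
               norm (residual g (x (k + 1)))
                 \<le> \<kappa> * theta g m x s k (\<alpha>bar k) * norm (residual g (x (s k 0))) + e k)) \<and>
         (\<forall>\<eta>. \<kappa> < \<eta> \<and> \<eta> < 1 \<longrightarrow>
            (\<exists>C>0. \<exists>l::nat. \<forall>k\<ge>l. norm (residual g (x k)) \<le> C * \<eta> ^ k))"
proof -
  obtain M where "M > 0" "\<forall>\<^sub>F k in sequentially. inf_norm (min m k) (\<alpha>bar k) \<le> M"
    using bounded by blast
  then interpret lm_aa_bounded g xstar x0 \<kappa> \<mu>0 p1 p2 \<eta>1 \<eta>2 c \<gamma> m x \<mu> s \<alpha> \<alpha>bar M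
    using assms by unfold_locales auto
  show ?thesis
    using res_Suc_asymptotic res_geometric by blast
qed

end
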